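(* Let $1\le a<b\le\infty$ and let $U$ be an operator (not necessarily linear or sublinear) such that for every $p\in(a,b)$ there is a finite non-zero constant with $|U[f]|_p\le K(p)\,|f|_p$ for all $f\in L_p(T,\mu)$, where $K(p)$ denotes the minimal such value, $$K(p)=\sup_{f\in L_p,\ f\ne0}\frac{|U[f]|_p}{|f|_p}.$$ Let $\langle\cdot\rangle$ be the norm defining a Composed Grand Lebesgue Space $CGLS(T,\mu;a,b;\langle\cdot\rangle)$ and define a new norm by $$|||g|||=\left\langle\,|g|_p/K(p)\,\right\rangle .$$ Then $$|||U[f]|||\le1\cdot\left\langle\,|f|_p\,\right\rangle$$ for all $f\in CGLS(T,\mu;a,b;\langle\cdot\rangle)$, and the constant $1$ is the best possible, i.e. it cannot be replaced by a smaller constant valid for all norms $\langle\cdot\rangle$ under consideration.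
   Context: Let $(T,\mathcal A,\mu)$ be a measurable space with a non-trivial sigma-finite measure $\mu$. For measurable $f:T\to\mathbb R$ put $|f|_p=\left(\int_T|f|^p\,d\mu\right)^{1/p}$, and $L_p=L_p(T,\mu)=\{f:|f|_p<\infty\}$. Let $\langle\cdot\rangle$ be a rearrangement invariant (function) norm on real functions defined on the interval $(a,b)$, not necessarily finite on all functions and assumed order continuous ($g_n\downarrow0$, $\langle g_n\rangle<\infty$ imply $\langle g_n\rangle\downarrow0$). The Composed Grand Lebesgue Space $CGLS(T,\mu;a,b;\langle\cdot\rangle)$ is the space of measurable $f:T\to\mathbb R$ with $\langle h\rangle<\infty$, $h(p)=|f|_p$, $p\in(a,b)$. The norms $\langle h\rangle=\left[\int_{[a,b]}|h(p)|^Q\,\nu(dp)\right]^{1/Q}$, with $Q\ge1$ and $\nu$ a sigma-finite Borel measure (including Dirac measures $\nu=\delta(p-p_0)$, $p_0\in(a,b)$, for which the space is $L_{p_0}$), are regarded as belonging to this class; the corresponding spaces are the Integral Grand Lebesgue Spaces. *)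

theory Defs
  imports "HOL-Analysis.Analysis"
begin

text \<open>
  Powers of extended nonnegative numbers; the exponent is positive wherever this is used,
  so that the power of \<open>\<infinity>\<close> is \<^term>\<open>top\<close>.
\<close>

definition epowr :: "ennreal \<Rightarrow> real \<Rightarrow> ennreal" where
  "epowr x r = (if x = top then top else ennreal (enn2real x powr r))"

definition Lp_norm :: "'t measure \<Rightarrow> real \<Rightarrow> ('t \<Rightarrow> real) \<Rightarrow> ennreal" where
  "Lp_norm M p f = epowr (\<integral>\<^sup>+ x. ennreal (\<bar>f x\<bar> powr p) \<partial>M) (1 / p)"

definition Lp_space :: "'t measure \<Rightarrow> real \<Rightarrow> ('t \<Rightarrow> real) set" where
  "Lp_space M p = {f \<in> borel_measurable M. Lp_norm M p f < \<infinity>}"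

definition exponents :: "real \<Rightarrow> ereal \<Rightarrow> real set" where
  "exponents a b = {p. a < p \<and> ereal p < b}"

text \<open>
  Rearrangement invariant, order continuous function norms on the interval \<^term>\<open>exponents a b\<close>.
  Rearrangement invariance and identification of functions almost everywhere refer to a
  sigma-finite Borel measure \<^term>\<open>N\<close> on the interval.  It is a parameter and not fixed to be
  Lebesgue measure, because the class has to contain the norms of \<open>L_Q(N)\<close> for every such
  \<^term>\<open>N\<close>, Dirac measures included.

  As is usual for function norms, \<^term>\<open>rho\<close> is given on nonnegative functions; the norm of
  \<open>h\<close> is \<open>rho \<bar>h\<bar>\<close>.  The value \<open>\<infinity>\<close> has to be admitted for the functions
  as well, since \<open>p \<mapsto> \<bar>f\<bar>_p\<close> may take it.

  All axioms concern Borel functions, except that \<^term>\<open>rho\<close> is monotone on all functions.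
  In particular nothing but monotonicity is prescribed on non-measurable functions; this gives
  \<open>rho (\<lambda>p. \<bar>g\<bar>_p / K p)\<close> a meaning also when \<open>K\<close>, a supremum of an
  uncountable family, is not measurable.
\<close>

locale ri_function_norm = sigma_finite_measure N
  for N :: "real measure" +
  fixes a :: real and b :: ereal and rho :: "(real \<Rightarrow> ennreal) \<Rightarrow> ennreal"
  assumes sets_N: "sets N = sets (restrict_space borel (exponents a b))"
    and mono: "(AE p in N. g p \<le> h p) \<Longrightarrow> rho g \<le> rho h"
    and definite: "g \<in> borel_measurable N \<Longrightarrow> rho g = 0 \<longleftrightarrow> (AE p in N. g p = 0)"
    and homogeneous: "g \<in> borel_measurable N \<Longrightarrow> 0 \<le> c
          \<Longrightarrow> rho (\<lambda>p. ennreal c * g p) = ennreal c * rho g"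
    and triangle: "g \<in> borel_measurable N \<Longrightarrow> h \<in> borel_measurable N
          \<Longrightarrow> rho (\<lambda>p. g p + h p) \<le> rho g + rho h"
    and rearrangement_invariant:
      "g \<in> borel_measurable N \<Longrightarrow> h \<in> borel_measurable N
          \<Longrightarrow> (\<And>t. emeasure N {p \<in> space N. t < g p} = emeasure N {p \<in> space N. t < h p})
          \<Longrightarrow> rho g = rho h"
    and order_continuous:
      "(\<And>n. G n \<in> borel_measurable N) \<Longrightarrow> (\<And>n. rho (G n) < \<infinity>)
          \<Longrightarrow> (\<And>p. p \<in> space N \<Longrightarrow> decseq (\<lambda>n. G n p) \<and> (\<lambda>n. G n p) \<longlonglongrightarrow> 0)
          \<Longrightarrow> (\<lambda>n. rho (G n)) \<longlonglongrightarrow> 0"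

definition CGLS_norms :: "real \<Rightarrow> ereal \<Rightarrow> ((real \<Rightarrow> ennreal) \<Rightarrow> ennreal) set" where
  "CGLS_norms a b = {rho. \<exists>N. ri_function_norm N a b rho}"

definition CGLS :: "'t measure \<Rightarrow> ((real \<Rightarrow> ennreal) \<Rightarrow> ennreal) \<Rightarrow> ('t \<Rightarrow> real) set" where
  "CGLS M rho = {f \<in> borel_measurable M. rho (\<lambda>p. Lp_norm M p f) < \<infinity>}"

text \<open>
  The minimal constant \<open>K(p)\<close> of the operator; \<open>f \<noteq> 0\<close> is meant in \<open>L_p\<close>, that is, modulo
  null sets.
\<close>

definition op_const :: "'t measure \<Rightarrow> (('t \<Rightarrow> real) \<Rightarrow> ('t \<Rightarrow> real)) \<Rightarrow> real \<Rightarrow> ennreal" where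
  "op_const M U p =
     (SUP f \<in> {f \<in> Lp_space M p. \<not> (AE x in M. f x = 0)}. Lp_norm M p (U f) / Lp_norm M p f)"

definition scaled_norm ::
  "'t measure \<Rightarrow> (('t \<Rightarrow> real) \<Rightarrow> ('t \<Rightarrow> real)) \<Rightarrow> ((real \<Rightarrow> ennreal) \<Rightarrow> ennreal)
     \<Rightarrow> ('t \<Rightarrow> real) \<Rightarrow> ennreal" where
  "scaled_norm M U rho g = rho (\<lambda>p. Lp_norm M p g / op_const M U p)"


text \<open>
  The norms of the Integral Grand Lebesgue Spaces.  They act on functions on the open interval,
  so \<^term>\<open>N\<close> lives there and does not charge the endpoints; \<open>N = \<delta>(p - p0)\<close>
  gives \<open>L_p0\<close>.
\<close>

definition integral_norm :: "real measure \<Rightarrow> real \<Rightarrow> (real \<Rightarrow> ennreal) \<Rightarrow> ennreal" where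
  "integral_norm N Q h = epowr (\<integral>\<^sup>+ p. epowr (h p) Q \<partial>N) (1 / Q)"

lemma epowr_0 [simp]: "epowr 0 r = 0"
  by (simp add: epowr_def)

lemma epowr_ennreal: "0 \<le> x \<Longrightarrow> epowr (ennreal x) r = ennreal (x powr r)"
  by (simp add: epowr_def)

lemma epowr_eq_0_iff [simp]: "epowr x r = 0 \<longleftrightarrow> x = 0"
  by (cases x) (auto simp: epowr_def)

lemma epowr_eq_top_iff [simp]: "epowr x r = top \<longleftrightarrow> x = top"
  by (auto simp: epowr_def)

lemma epowr_strict_mono: assumes "0 < r" "x < y" shows "epowr x r < epowr y r"
proof (cases y)
  case (real v)
  then obtain u where u: "x = ennreal u" "0 \<le> u" using assms by (cases x) auto
  then show ?thesis using assms real
    by (auto simp: epowr_ennreal ennreal_less_iff intro!: powr_less_mono2)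
qed (use assms in \<open>auto simp: epowr_def\<close>)

lemma epowr_mono: assumes "0 < r" "x \<le> y" shows "epowr x r \<le> epowr y r"
  using epowr_strict_mono[of r x y] assms by (cases "x = y") (auto intro: less_imp_le)

lemma epowr_epowr: assumes "0 < r" shows "epowr (epowr x r) (1 / r) = x"
    and "epowr (epowr x (1 / r)) r = x"
  using assms by (cases x; auto simp: epowr_def powr_powr)+

lemma epowr_less_iff: assumes "0 < r" shows "t < epowr x r \<longleftrightarrow> epowr t (1 / r) < x"
  by (metis assms epowr_epowr(1,2) epowr_strict_mono zero_less_divide_1_iff)

lemma epowr_mult: assumes "0 < r" "0 \<le> c"
  shows "epowr (ennreal c * x) r = ennreal (c powr r) * epowr x r"
proof (cases x)
  case (real u)
  then show ?thesis using assms
    by (simp add: epowr_ennreal ennreal_mult'[symmetric] powr_mult)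
next
  case top
  then show ?thesis using assms by (cases "c = 0") (auto simp: epowr_def ennreal_mult_top)
qed

lemma epowr_measurable [measurable]:
  assumes [measurable]: "g \<in> borel_measurable N"
  shows "(\<lambda>p. epowr (g p) r) \<in> borel_measurable N"
  unfolding epowr_def by measurable

lemma epowr_tendsto_0: assumes "0 < r" "(x \<longlongrightarrow> 0) F" shows "((\<lambda>n. epowr (x n) r) \<longlongrightarrow> 0) F"
proof (rule order_tendstoI)
  fix e :: ennreal assume "0 < e"
  then have "0 < epowr e (1 / r)" by (simp add: zero_less_iff_neq_zero)
  from order_tendstoD(2)[OF assms(2) this] show "\<forall>\<^sub>F n in F. epowr (x n) r < e"
  proof eventually_elim
    case (elim n)
    then show ?case using epowr_strict_mono[OF assms(1) elim] assms by (simp add: epowr_epowr)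
  qed
qed auto

lemma powr_convex_nonneg:
  fixes Q l m x y :: real
  assumes "1 \<le> Q" "0 < l" "0 < m" "l + m = 1" "0 \<le> x" "0 \<le> y"
  shows "(l * x + m * y) powr Q \<le> l * x powr Q + m * y powr Q"
proof -
  have *: "k powr Q \<le> k" if "0 < k" "k \<le> 1" for k
    using powr_mono'[of 1 Q k] that assms by simp
  consider "x = 0" | "y = 0" | "0 < x" "0 < y" using assms by force
  then show ?thesis
  proof cases
    case 1
    then show ?thesis using *[of m] assms by (auto simp: powr_mult intro!: mult_right_mono)
  next
    case 2
    then show ?thesis using *[of l] assms by (auto simp: powr_mult intro!: mult_right_mono)
  next
    case 3
    then show ?thesis
      using convex_onD[OF powr_convex[OF assms(1)], of m x y] assms
      by (simp add: eq_diff_eq[symmetric])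
  qed
qed

lemma epowr_convex:
  assumes "1 \<le> Q" "0 < l" "0 < m" "l + m = 1"
  shows "epowr (ennreal l * x + ennreal m * y) Q \<le> ennreal l * epowr x Q + ennreal m * epowr y Q"
proof (cases x; cases y)
  fix u v assume "x = ennreal u" "0 \<le> u" "y = ennreal v" "0 \<le> v"
  then show ?thesis using assms powr_convex_nonneg[OF assms, of u v]
    by (simp add: epowr_ennreal ennreal_mult'[symmetric] ennreal_plus[symmetric]
          del: ennreal_plus)
qed (use assms in \<open>auto simp: epowr_def ennreal_mult_top\<close>)

lemma integral_norm_triangle:
  assumes Q: "1 \<le> Q" and [measurable]: "g \<in> borel_measurable N" "h \<in> borel_measurable N"
  shows "integral_norm N Q (\<lambda>p. g p + h p) \<le> integral_norm N Q g + integral_norm N Q h"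
proof -
  have int: "(\<integral>\<^sup>+ p. epowr (k p) Q \<partial>N) = epowr (integral_norm N Q k) Q" for k
    using Q by (simp add: integral_norm_def epowr_epowr)
  have null: "AE p in N. k p = 0" if "integral_norm N Q k = 0" "k \<in> borel_measurable N" for k
  proof -
    note [measurable] = that(2)
    have "(\<integral>\<^sup>+ p. epowr (k p) Q \<partial>N) = 0" using that by (simp add: int)
    then show ?thesis by (subst (asm) nn_integral_0_iff_AE) auto
  qed
  consider "integral_norm N Q g = top \<or> integral_norm N Q h = top"
    | "integral_norm N Q g = 0" | "integral_norm N Q h = 0"
    | A B where "integral_norm N Q g = ennreal A" "integral_norm N Q h = ennreal B" "0 < A" "0 < B"
    by (cases "integral_norm N Q g"; cases "integral_norm N Q h")
       (auto simp: less_le)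
  then show ?thesis
  proof cases
    case 1
    then show ?thesis by auto
  next
    case 2
    from null[OF this] have "(\<integral>\<^sup>+ p. epowr (g p + h p) Q \<partial>N) = (\<integral>\<^sup>+ p. epowr (h p) Q \<partial>N)"
      by (intro nn_integral_cong_AE) auto
    then show ?thesis by (simp add: integral_norm_def)
  next
    case 3
    from null[OF this] have "(\<integral>\<^sup>+ p. epowr (g p + h p) Q \<partial>N) = (\<integral>\<^sup>+ p. epowr (g p) Q \<partial>N)"
      by (intro nn_integral_cong_AE) auto
    then show ?thesis by (simp add: integral_norm_def)
  next
    case (4 A B)
    let ?S = "A + B"
    have S: "0 < ?S" and Q0: "0 < Q" using 4 Q by auto
    have one: "ennreal ((1 / C) powr Q) * epowr (ennreal C) Q = 1" if "0 < C" for C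
      using that by (simp add: epowr_ennreal ennreal_mult'[symmetric] powr_mult[symmetric])
    have pt: "epowr (g p + h p) Q \<le> ennreal (?S powr Q) *
        (ennreal (A / ?S) * (ennreal ((1 / A) powr Q) * epowr (g p) Q) +
         ennreal (B / ?S) * (ennreal ((1 / B) powr Q) * epowr (h p) Q))" for p
    proof -
      have eq: "x = ennreal ?S * (ennreal (C / ?S) * (ennreal (1 / C) * x))" if "0 < C" for C x
      proof -
        have "ennreal ?S * (ennreal (C / ?S) * (ennreal (1 / C) * x))
              = ennreal (?S * (C / ?S) * (1 / C)) * x"
          using that S by (simp only: ennreal_mult' mult.assoc divide_nonneg_pos less_imp_le
              mult_nonneg_nonneg zero_le_one)
        then show ?thesis using that S by simp
      qed
      have "g p + h p = ennreal ?S * (ennreal (A / ?S) * (ennreal (1 / A) * g p)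
               + ennreal (B / ?S) * (ennreal (1 / B) * h p))"
        unfolding distrib_left using eq[OF 4(3), of "g p"] eq[OF 4(4), of "h p"] by simp
      then have "epowr (g p + h p) Q = ennreal (?S powr Q) *
           epowr (ennreal (A / ?S) * (ennreal (1 / A) * g p)
               + ennreal (B / ?S) * (ennreal (1 / B) * h p)) Q"
        using epowr_mult[OF Q0, of ?S] S by simp
      also have "\<dots> \<le> ennreal (?S powr Q) *
        (ennreal (A / ?S) * epowr (ennreal (1 / A) * g p) Q
         + ennreal (B / ?S) * epowr (ennreal (1 / B) * h p) Q)"
        using 4 S Q by (intro mult_left_mono epowr_convex) (auto simp: add_divide_distrib[symmetric])
      finally show ?thesis using 4 Q0 by (simp add: epowr_mult)
    qed
    have "(\<integral>\<^sup>+ p. epowr (g p + h p) Q \<partial>N) \<le> (\<integral>\<^sup>+ p. ennreal (?S powr Q) *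
        (ennreal (A / ?S) * (ennreal ((1 / A) powr Q) * epowr (g p) Q) +
         ennreal (B / ?S) * (ennreal ((1 / B) powr Q) * epowr (h p) Q)) \<partial>N)"
      by (intro nn_integral_mono pt)
    also have "\<dots> = ennreal (?S powr Q) *
        (ennreal (A / ?S) * (ennreal ((1 / A) powr Q) * epowr (ennreal A) Q) +
         ennreal (B / ?S) * (ennreal ((1 / B) powr Q) * epowr (ennreal B) Q))"
      by (simp add: nn_integral_cmult nn_integral_add int 4)
    also have "\<dots> = ennreal (?S powr Q) * (ennreal (A / ?S) + ennreal (B / ?S))"
      using one[OF 4(3)] one[OF 4(4)] by simp
    also have "\<dots> = epowr (ennreal ?S) Q"
      using 4 S by (simp add: epowr_ennreal ennreal_plus[symmetric] add_divide_distrib[symmetric]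
            del: ennreal_plus)
    finally have "epowr (\<integral>\<^sup>+ p. epowr (g p + h p) Q \<partial>N) (1 / Q) \<le> epowr (epowr (ennreal ?S) Q) (1 / Q)"
      using Q0 by (intro epowr_mono) auto
    then show ?thesis using 4 Q0 by (simp add: epowr_epowr integral_norm_def)
  qed
qed

lemma (in sigma_finite_measure) nn_integral_layer_cake:
  assumes [measurable]: "u \<in> borel_measurable M"
  shows "(\<integral>\<^sup>+ x. u x \<partial>M) =
    (\<integral>\<^sup>+ t. indicator {0..} t * emeasure M {x \<in> space M. ennreal t < u x} \<partial>lborel)"
proof -
  interpret pair_sigma_finite M lborel ..
  have len: "(\<integral>\<^sup>+ t. indicator {t. 0 \<le> t \<and> ennreal t < y} t \<partial>lborel) = y" for y
  proof (cases y)
    case (real r)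
    then have "{t. 0 \<le> t \<and> ennreal t < y} = {0..<r}" by (auto simp: ennreal_less_iff)
    then show ?thesis using real by simp
  next
    case top
    then have "{t. 0 \<le> t \<and> ennreal t < y} = {0..}" by auto
    moreover have "emeasure lborel {0::real..} = top"
    proof (rule ccontr)
      assume "emeasure lborel {0::real..} \<noteq> top"
      then obtain n :: nat where "emeasure lborel {0::real..} < of_nat n"
        using ennreal_Ex_less_of_nat by (auto simp: less_top)
      moreover have "of_nat n \<le> emeasure lborel {0::real..}"
        using emeasure_mono[of "{0..real n}" "{0..}" lborel]
        by (simp add: ennreal_of_nat_eq_real_of_nat)
      ultimately show False by simp
    qed
    ultimately show ?thesis using top by simp
  qed
  have "(\<integral>\<^sup>+ x. u x \<partial>M) =
     (\<integral>\<^sup>+ x. \<integral>\<^sup>+ t. indicator {t. 0 \<le> t \<and> ennreal t < u x} t \<partial>lborel \<partial>M)"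
    by (simp only: len)
  also have "\<dots> = (\<integral>\<^sup>+ x. \<integral>\<^sup>+ t. (if 0 \<le> t \<and> ennreal t < u x then 1 else 0) \<partial>lborel \<partial>M)"
    by (intro nn_integral_cong) (auto simp: indicator_def)
  also have "\<dots> = (\<integral>\<^sup>+ t. \<integral>\<^sup>+ x. (if 0 \<le> t \<and> ennreal t < u x then 1 else 0) \<partial>M \<partial>lborel)"
    by (rule Fubini'[symmetric]) measurable
  also have "\<dots> = (\<integral>\<^sup>+ t. indicator {0..} t * emeasure M {x \<in> space M. ennreal t < u x} \<partial>lborel)"
  proof (rule nn_integral_cong)
    fix t :: real
    have "(\<integral>\<^sup>+ x. (if 0 \<le> t \<and> ennreal t < u x then 1 else 0) \<partial>M) =
       (\<integral>\<^sup>+ x. indicator {0..} t * indicator {x \<in> space M. ennreal t < u x} x \<partial>M)"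
      by (intro nn_integral_cong) (auto simp: indicator_def)
    then show "(\<integral>\<^sup>+ x. (if 0 \<le> t \<and> ennreal t < u x then 1 else 0) \<partial>M) =
        indicator {0..} t * emeasure M {x \<in> space M. ennreal t < u x}"
      by (simp add: nn_integral_cmult)
  qed
  finally show ?thesis .
qed

lemma integral_norm_in_CGLS_norms:
  assumes "sigma_finite_measure N" "sets N = sets (restrict_space borel (exponents a b))" "1 \<le> Q"
  shows "integral_norm N Q \<in> CGLS_norms a b"
proof -
  interpret sigma_finite_measure N by fact
  have Q: "0 < Q" "0 < 1 / Q" using assms by auto
  have "ri_function_norm N a b (integral_norm N Q)"
  proof
    fix g h :: "real \<Rightarrow> ennreal"
    assume "AE p in N. g p \<le> h p"
    then show "integral_norm N Q g \<le> integral_norm N Q h"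
      unfolding integral_norm_def
      by (intro epowr_mono Q nn_integral_mono_AE) (auto elim!: eventually_mono intro: epowr_mono Q)
  next
    fix g :: "real \<Rightarrow> ennreal" assume [measurable]: "g \<in> borel_measurable N"
    show "integral_norm N Q g = 0 \<longleftrightarrow> (AE p in N. g p = 0)"
      by (simp add: integral_norm_def nn_integral_0_iff_AE)
    fix c :: real assume c: "0 \<le> c"
    have "(\<integral>\<^sup>+ p. epowr (ennreal c * g p) Q \<partial>N) = ennreal (c powr Q) * (\<integral>\<^sup>+ p. epowr (g p) Q \<partial>N)"
      using c Q by (simp add: epowr_mult nn_integral_cmult)
    then show "integral_norm N Q (\<lambda>p. ennreal c * g p) = ennreal c * integral_norm N Q g"
      using c Q by (simp add: integral_norm_def epowr_mult powr_powr)
  next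
    fix g h :: "real \<Rightarrow> ennreal"
    assume [measurable]: "g \<in> borel_measurable N" "h \<in> borel_measurable N"
    assume "\<And>t. emeasure N {p \<in> space N. t < g p} = emeasure N {p \<in> space N. t < h p}"
    then have "(\<integral>\<^sup>+ p. epowr (g p) Q \<partial>N) = (\<integral>\<^sup>+ p. epowr (h p) Q \<partial>N)"
      using Q by (simp add: nn_integral_layer_cake epowr_less_iff)
    then show "integral_norm N Q g = integral_norm N Q h" by (simp add: integral_norm_def)
  next
    fix G :: "nat \<Rightarrow> real \<Rightarrow> ennreal"
    assume [measurable]: "\<And>n. G n \<in> borel_measurable N"
      and fin: "\<And>n. integral_norm N Q (G n) < \<infinity>"
      and lim: "\<And>p. p \<in> space N \<Longrightarrow> decseq (\<lambda>n. G n p) \<and> (\<lambda>n. G n p) \<longlonglongrightarrow> 0"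
    have "(\<lambda>n. \<integral>\<^sup>+ p. epowr (G n p) Q \<partial>N) \<longlonglongrightarrow> (\<integral>\<^sup>+ p. 0 \<partial>N)"
    proof (rule nn_integral_dominated_convergence[where w = "\<lambda>p. epowr (G 0 p) Q"])
      show "(\<integral>\<^sup>+ p. epowr (G 0 p) Q \<partial>N) < \<infinity>"
        using fin[of 0] by (simp add: integral_norm_def less_top[symmetric])
      show "AE p in N. epowr (G j p) Q \<le> epowr (G 0 p) Q" for j
        using lim by (intro AE_I2 epowr_mono Q) (auto simp: decseq_def)
      show "AE p in N. (\<lambda>n. epowr (G n p) Q) \<longlonglongrightarrow> 0"
        using lim by (intro AE_I2 epowr_tendsto_0 Q) auto
    qed measurable
    then show "(\<lambda>n. integral_norm N Q (G n)) \<longlonglongrightarrow> 0"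
      unfolding integral_norm_def by (intro epowr_tendsto_0 Q) simp
  qed (use assms integral_norm_triangle in auto)
  then show ?thesis by (auto simp: CGLS_norms_def)
qed

end

theory Submission
  imports Defs "HOL-Probability.Giry_Monad"
begin

text \<open>
  The inequality holds already before the function norm is applied: for each single exponent
  \<open>p\<close> one has \<open>\<bar>U f\<bar>_p / K(p) \<le> \<bar>f\<bar>_p\<close>, by the very definition of \<open>K(p)\<close> as a supremum of
  quotients (lemma \<open>Lp_norm_image_div_op_const_le\<close>).  Monotonicity of the function norm
  carries this over to the composed norms.

  For the optimality of the constant it suffices to look at one exponent \<open>p0\<close> and the Dirac
  measure at \<open>p0\<close>.  The function norm is then evaluation at \<open>p0\<close> (lemma
  \<open>integral_norm_return\<close>), the space is \<open>L_p0\<close>, and an inequality with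
  constant \<open>C < 1\<close> would bound every quotient \<open>\<bar>U f\<bar>_p0 / \<bar>f\<bar>_p0\<close> by \<open>C K(p0) < K(p0)\<close>.
  This contradicts the minimality of \<open>K(p0)\<close>, since \<open>0 < K(p0) < \<infinity>\<close>.
\<close>

lemma Lp_norm_eq_0_iff_AE:
  assumes [measurable]: "f \<in> borel_measurable M"
  shows "Lp_norm M p f = 0 \<longleftrightarrow> (AE x in M. f x = 0)"
  by (simp add: Lp_norm_def nn_integral_0_iff_AE)

text \<open>
  The minimality of \<open>K(p)\<close> among the constants admissible at \<open>p\<close>: it gives finiteness of \<open>K(p)\<close>
  from the a priori bound, and the contradiction from an improved one.
\<close>

lemma op_const_le:
  assumes bound: "\<And>f. f \<in> Lp_space M p \<Longrightarrow> Lp_norm M p (U f) \<le> C * Lp_norm M p f"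
  shows "op_const M U p \<le> C"
  unfolding op_const_def
proof (rule SUP_least)
  fix f assume f: "f \<in> {f \<in> Lp_space M p. \<not> (AE x in M. f x = 0)}"
  then have "Lp_norm M p f \<noteq> 0" "Lp_norm M p f \<noteq> top"
    by (auto simp: Lp_space_def Lp_norm_eq_0_iff_AE)
  then show "Lp_norm M p (U f) / Lp_norm M p f \<le> C"
    using bound[of f] f
    by (intro divide_le_posI_ennreal) (auto simp: zero_less_iff_neq_zero mult.commute)
qed

text \<open>
  The supremum \<open>K(p)\<close> runs over the non-zero elements of \<open>L_p\<close> only, so the two excluded cases
  need arguments of their own.  On null functions the a priori bound forces
  \<open>\<bar>U f\<bar>_p = 0\<close>, whatever its constant \<open>C\<close> is; outside \<open>L_p\<close> the right-hand side is infinite.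
\<close>

lemma Lp_norm_image_div_op_const_le:
  fixes C :: ennreal
  assumes f: "f \<in> borel_measurable M"
    and bound: "\<And>f. f \<in> Lp_space M p \<Longrightarrow> Lp_norm M p (U f) \<le> C * Lp_norm M p f"
    and K: "op_const M U p \<noteq> 0"
  shows "Lp_norm M p (U f) / op_const M U p \<le> Lp_norm M p f"
proof (cases "f \<in> Lp_space M p")
  case False
  then have "Lp_norm M p f = top" using f by (auto simp: Lp_space_def less_top[symmetric])
  then show ?thesis by simp
next
  case True
  show ?thesis
  proof (cases "AE x in M. f x = 0")
    case null: True
    then have "Lp_norm M p (U f) = 0"
      using bound[OF True] f by (simp add: Lp_norm_eq_0_iff_AE[THEN iffD2])
    then show ?thesis by simp
  next
    case False
    then have pos: "0 < Lp_norm M p f"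
      using f by (simp add: Lp_norm_eq_0_iff_AE zero_less_iff_neq_zero)
    moreover have "Lp_norm M p (U f) / Lp_norm M p f \<le> op_const M U p"
      unfolding op_const_def using True False by (intro SUP_upper) auto
    moreover have fin: "Lp_norm M p f < top" using True by (simp add: Lp_space_def)
    ultimately have "Lp_norm M p (U f) / Lp_norm M p f * Lp_norm M p f
        \<le> op_const M U p * Lp_norm M p f"
      by (intro mult_right_mono) auto
    with pos fin have "Lp_norm M p (U f) \<le> op_const M U p * Lp_norm M p f"
      by (simp add: ennreal_divide_times)
    then show ?thesis
      using K by (intro divide_le_posI_ennreal) (simp_all add: zero_less_iff_neq_zero)
  qed
qed

text \<open>
  Since the singleton is measurable, every function \<open>h\<close> agrees almost everywhere with the
  constant \<open>h p0\<close>.  This covers \<open>h p = \<bar>g\<bar>_p / K(p)\<close>, where \<open>K\<close> is a supremum of an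
  uncountable family and may fail to be measurable.
\<close>

lemma integral_norm_return:
  assumes "{p0} \<in> sets A" and "0 < Q"
  shows "integral_norm (return A p0) Q h = h p0"
proof -
  have p0: "p0 \<in> space A" using sets.sets_into_space[OF assms(1)] by simp
  have "{p \<in> space A. p = p0} = {p0}" using p0 by auto
  then have "AE p in return A p0. p = p0"
    using assms(1) p0 by (simp add: AE_return pred_def)
  then have "(\<integral>\<^sup>+ p. epowr (h p) Q \<partial>return A p0) = (\<integral>\<^sup>+ p. epowr (h p0) Q \<partial>return A p0)"
    by (intro nn_integral_cong_AE) auto
  also have "\<dots> = epowr (h p0) Q" using p0 by (simp add: nn_integral_return)
  finally show ?thesis using assms(2) by (simp add: integral_norm_def epowr_epowr)
qed

lemma evaluation_in_CGLS_norms: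
  assumes "p0 \<in> exponents a b"
  shows "(\<lambda>h. h p0) \<in> CGLS_norms a b"
proof -
  let ?A = "restrict_space borel (exponents a b)"
  have sing: "{p0} \<in> sets ?A" using assms by (auto simp: sets_restrict_space)
  interpret prob_space "return ?A p0"
    using assms by (intro prob_space_return) (simp add: space_restrict_space)
  have "integral_norm (return ?A p0) 1 \<in> CGLS_norms a b"
    by (rule integral_norm_in_CGLS_norms) (simp_all add: sigma_finite_measure_axioms)
  moreover have "integral_norm (return ?A p0) 1 = (\<lambda>h. h p0)"
    using integral_norm_return[OF sing] by fastforce
  ultimately show ?thesis by simp
qed

theorem theorem9p1:
  fixes M :: "'t measure" and a :: real and b :: ereal
    and U :: "('t \<Rightarrow> real) \<Rightarrow> ('t \<Rightarrow> real)"
  assumes "sigma_finite_measure M" and "emeasure M (space M) \<noteq> 0"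
    and "1 \<le> a" and "ereal a < b"
    and "\<And>p f. p \<in> exponents a b \<Longrightarrow> f \<in> Lp_space M p \<Longrightarrow> U f \<in> borel_measurable M"
    and "\<And>p. p \<in> exponents a b \<Longrightarrow>
           \<exists>C::real. 0 < C \<and> (\<forall>f\<in>Lp_space M p. Lp_norm M p (U f) \<le> ennreal C * Lp_norm M p f)"
    and "\<And>p. p \<in> exponents a b \<Longrightarrow> op_const M U p \<noteq> 0"
  shows "(\<forall>rho\<in>CGLS_norms a b. \<forall>f\<in>CGLS M rho.
            scaled_norm M U rho (U f) \<le> 1 * rho (\<lambda>p. Lp_norm M p f)) \<and>
         \<not> (\<exists>C::ennreal. C < 1 \<and>
              (\<forall>rho\<in>CGLS_norms a b. \<forall>f\<in>CGLS M rho.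
                 scaled_norm M U rho (U f) \<le> C * rho (\<lambda>p. Lp_norm M p f)))"
proof (intro conjI ballI notI)
  fix rho f assume "rho \<in> CGLS_norms a b" and f: "f \<in> CGLS M rho"
  then obtain N where "ri_function_norm N a b rho" by (auto simp: CGLS_norms_def)
  then interpret ri_function_norm N a b rho .
  have space: "space N = exponents a b"
    using sets_eq_imp_space_eq[OF sets_N] by (simp add: space_restrict_space)
  have "Lp_norm M p (U f) / op_const M U p \<le> Lp_norm M p f" if p: "p \<in> exponents a b" for p
  proof -
    obtain C where "\<forall>f\<in>Lp_space M p. Lp_norm M p (U f) \<le> ennreal C * Lp_norm M p f"
      using assms(6)[OF p] by auto
    then show ?thesis
      using f assms(7)[OF p]
      by (intro Lp_norm_image_div_op_const_le[where C = "ennreal C"]) (auto simp: CGLS_def)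
  qed
  then show "scaled_norm M U rho (U f) \<le> 1 * rho (\<lambda>p. Lp_norm M p f)"
    unfolding scaled_norm_def by (auto simp: space intro!: mono AE_I2)
next
  assume "\<exists>C::ennreal. C < 1 \<and> (\<forall>rho\<in>CGLS_norms a b. \<forall>f\<in>CGLS M rho.
                 scaled_norm M U rho (U f) \<le> C * rho (\<lambda>p. Lp_norm M p f))"
  then obtain C :: ennreal where C: "C < 1"
    and better: "\<And>rho f. rho \<in> CGLS_norms a b \<Longrightarrow> f \<in> CGLS M rho \<Longrightarrow>
                 scaled_norm M U rho (U f) \<le> C * rho (\<lambda>p. Lp_norm M p f)"
    by blast
  obtain p0 where p0: "p0 \<in> exponents a b"
    using ereal_dense2[OF assms(4)] by (auto simp: exponents_def)
  let ?K = "op_const M U p0"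
  have K0: "?K \<noteq> 0" by (rule assms(7)[OF p0])
  obtain D where "\<forall>f\<in>Lp_space M p0. Lp_norm M p0 (U f) \<le> ennreal D * Lp_norm M p0 f"
    using assms(6)[OF p0] by auto
  then have "?K \<le> ennreal D" by (intro op_const_le) auto
  then have K_top: "?K < top" using ennreal_less_top le_less_trans by blast
  have "?K \<le> C * ?K"
  proof (rule op_const_le)
    fix f assume "f \<in> Lp_space M p0"
    then have "f \<in> CGLS M (\<lambda>h. h p0)" by (simp add: Lp_space_def CGLS_def)
    from better[OF evaluation_in_CGLS_norms[OF p0] this]
    have le: "Lp_norm M p0 (U f) / ?K \<le> C * Lp_norm M p0 f" by (simp add: scaled_norm_def)
    have "Lp_norm M p0 (U f) = Lp_norm M p0 (U f) / ?K * ?K"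
      using K0 K_top by (simp add: ennreal_divide_times)
    also have "\<dots> \<le> C * Lp_norm M p0 f * ?K" by (intro mult_right_mono le) simp
    finally show "Lp_norm M p0 (U f) \<le> C * ?K * Lp_norm M p0 f" by (simp add: ac_simps)
  qed
  moreover have "C * ?K < ?K"
    using ennreal_mult_strict_right_mono[OF C, of ?K] K0 K_top by (simp add: zero_less_iff_neq_zero)
  ultimately show False by simp
qed

end
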